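(* Let $(\mathfrak g,D)$ be a regular pre-LieDer pair. Then $(\bigoplus_{n=0}^{+\infty}C^n(\mathfrak g,D),\bar{\mathcal D})$, with cochains and operator $\bar{\mathcal D}$ as defined in the context, is a cochain complex, i.e. $\bar{\mathcal D}\circ\bar{\mathcal D}=0$.
   Context: All vector spaces are over an algebraically closed field $\mathbb K$ of characteristic $0$. Pre-Lie algebra: a vector space $\mathfrak g$ with a bilinear product $\cdot$ such that $(x\cdot y)\cdot z-x\cdot(y\cdot z)=(y\cdot x)\cdot z-y\cdot(x\cdot z)$; $[x,y]_C=x\cdot y-y\cdot x$. A regular pre-LieDer pair $(\mathfrak g,D)$ is a pre-Lie algebra $(\mathfrak g,\cdot)$ with a linear map $D:\mathfrak g\to\mathfrak g$ satisfying $D(x\cdot y)=x\cdot D(y)+D(x)\cdot y$. Cochains: $C^0(\mathfrak g,D)=0$, $C^1(\mathfrak g,D)=\mathrm{Hom}(\mathfrak g,\mathfrak g)$ and for $n\ge2$, $C^n(\mathfrak g,D)=\mathrm{Hom}(\wedge^{n-1}\mathfrak g\otimes\mathfrak g,\mathfrak g)\oplus\mathrm{Hom}(\wedge^{n-2}\mathfrak g\otimes\mathfrak g,\mathfrak g)$. For $n\ge1$ and $f\in\mathrm{Hom}(\wedge^{n-1}\mathfrak g\otimes\mathfrak g,\mathfrak g)$, $\mathrm d_{\mathrm{reg}}f\in\mathrm{Hom}(\wedge^{n}\mathfrak g\otimes\mathfrak g,\mathfrak g)$ is $$(\mathrm d_{\mathrm{reg}}f)(x_1,\dots,x_{n+1})=\sum_{i=1}^n(-1)^{i+1}x_i\cdot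 f(x_1,\dots,\hat{x_i},\dots,x_{n+1})+\sum_{i=1}^n(-1)^{i+1}f(x_1,\dots,\hat{x_i},\dots,x_n,x_i)\cdot x_{n+1}$$ $$-\sum_{i=1}^n(-1)^{i+1}f(x_1,\dots,\hat{x_i},\dots,x_n,x_i\cdot x_{n+1})+\sum_{1\le i<j\le n}(-1)^{i+j}f([x_i,x_j]_C,x_1,\dots,\hat{x_i},\dots,\hat{x_j},\dots,x_{n+1}),$$ and $\Omega f\in\mathrm{Hom}(\wedge^{n-1}\mathfrak g\otimes\mathfrak g,\mathfrak g)$ is $$(\Omega f)(x_1,\dots,x_n)=(-1)^{n-2}\Big(\sum_{i=1}^nf(x_1,\dots,x_{i-1},D(x_i),x_{i+1},\dots,x_n)-D(f(x_1,\dots,x_n))\Big).$$ The operator $\bar{\mathcal D}:C^n(\mathfrak g,D)\to C^{n+1}(\mathfrak g,D)$ is $\bar{\mathcal D}(f,\theta)=(\mathrm d_{\mathrm{reg}}f,\mathrm d_{\mathrm{reg}}\theta+\Omega f)$ for $f\in\mathrm{Hom}(\wedge^{n-1}\mathfrak g\otimes\mathfrak g,\mathfrak g)$, $\theta\in\mathrm{Hom}(\wedge^{n-2}\mathfrak g\otimes\mathfrak g,\mathfrak g)$ ($\theta=0$ for $n=1$). *)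

theory Defs
  imports
    "HOL-Computational_Algebra.Polynomial"
    "HOL-Library.Function_Algebras"
    "HOL-Library.Product_Plus"
begin

locale pre_lie_algebra = vector_space scale
  for scale :: "'k::{alg_closed_field, field_char_0} \<Rightarrow> 'g::ab_group_add \<Rightarrow> 'g" +
  fixes dot :: "'g \<Rightarrow> 'g \<Rightarrow> 'g"
  assumes dot_linear_left: "Vector_Spaces.linear scale scale (\<lambda>x. dot x y)"
    and dot_linear_right: "Vector_Spaces.linear scale scale (dot x)"
    and left_symmetric:
      "dot (dot x y) z - dot x (dot y z) = dot (dot y x) z - dot y (dot x z)"

locale regular_pre_LieDer_pair = pre_lie_algebra scale dot
  for scale :: "'k::{alg_closed_field, field_char_0} \<Rightarrow> 'g::ab_group_add \<Rightarrow> 'g"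
    and dot :: "'g \<Rightarrow> 'g \<Rightarrow> 'g" +
  fixes D :: "'g \<Rightarrow> 'g"
  assumes D_linear: "Vector_Spaces.linear scale scale D"
    and D_derivation: "D (dot x y) = dot x (D y) + dot (D x) y"

definition comm_bracket :: "('g::ab_group_add \<Rightarrow> 'g \<Rightarrow> 'g) \<Rightarrow> 'g \<Rightarrow> 'g \<Rightarrow> 'g" where
  "comm_bracket dot x y = dot x y - dot y x"

text \<open>
  \<open>Hom_wedge scale m\<close> is the space Hom(\<open>\<Lambda>\<^sup>m g \<otimes> g, g\<close>), encoded through the universal property as
  the maps in \<open>m + 1\<close> arguments that are linear in each argument and alternating in the first
  \<open>m\<close>. The arguments are passed as a list; the value on lists of any other length is fixed
  to be 0, so that cochains are equal iff they are equal as functions.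
\<close>

definition Hom_wedge ::
  "('k::field \<Rightarrow> 'g::ab_group_add \<Rightarrow> 'g) \<Rightarrow> nat \<Rightarrow> ('g list \<Rightarrow> 'g) set" where
  "Hom_wedge scale m =
    {f. (\<forall>xs i. length xs = m + 1 \<longrightarrow> i < m + 1 \<longrightarrow>
            Vector_Spaces.linear scale scale (\<lambda>v. f (xs[i := v]))) \<and>
        (\<forall>xs i j. length xs = m + 1 \<longrightarrow> i < j \<longrightarrow> j < m \<longrightarrow> xs ! i = xs ! j \<longrightarrow> f xs = 0) \<and>
        (\<forall>xs. length xs \<noteq> m + 1 \<longrightarrow> f xs = 0)}"

text \<open>
  In both operators below \<open>n\<close> is the number of arguments of \<open>f\<close>. List positions count
  from 0, so \<open>x\<^sub>i\<close> is \<open>xs ! (i - 1)\<close> and the sign \<open>(-1)\<^sup>i\<^sup>+\<^sup>1\<close> attached to \<open>x\<^sub>i\<close> becomes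
  \<open>(-1) ^ i\<close> in terms of the position; the sign \<open>(-1)\<^sup>i\<^sup>+\<^sup>j\<close> is unaffected by the shift.
  \<open>nths xs (- {i})\<close> is \<open>xs\<close> with position \<open>i\<close> omitted.
\<close>

definition d_reg ::
  "('k::field \<Rightarrow> 'g::ab_group_add \<Rightarrow> 'g) \<Rightarrow> ('g \<Rightarrow> 'g \<Rightarrow> 'g) \<Rightarrow> nat \<Rightarrow>
    ('g list \<Rightarrow> 'g) \<Rightarrow> 'g list \<Rightarrow> 'g" where
  "d_reg scale dot n f xs =
    (if length xs = n + 1 then
       (\<Sum>i<n. scale ((-1) ^ i) (dot (xs ! i) (f (nths xs (- {i})))))
     + (\<Sum>i<n. scale ((-1) ^ i) (dot (f (nths (butlast xs) (- {i}) @ [xs ! i])) (last xs)))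
     - (\<Sum>i<n. scale ((-1) ^ i) (f (nths (butlast xs) (- {i}) @ [dot (xs ! i) (last xs)])))
     + (\<Sum>j<n. \<Sum>i<j. scale ((-1) ^ (i + j))
          (f (comm_bracket dot (xs ! i) (xs ! j) # nths xs (- {i, j}))))
     else 0)"

definition Omega ::
  "('k::field \<Rightarrow> 'g::ab_group_add \<Rightarrow> 'g) \<Rightarrow> ('g \<Rightarrow> 'g) \<Rightarrow> nat \<Rightarrow>
    ('g list \<Rightarrow> 'g) \<Rightarrow> 'g list \<Rightarrow> 'g" where
  "Omega scale D n f xs =
    (if length xs = n then
       scale ((-1) powi (int n - 2)) ((\<Sum>i<n. f (xs[i := D (xs ! i)])) - D (f xs))
     else 0)"

text \<open>
  All cochain spaces are embedded in one type of pairs, with second component 0 in degree 1.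
\<close>

type_synonym 'g cochain = "('g list \<Rightarrow> 'g) \<times> ('g list \<Rightarrow> 'g)"

definition cochain_scale ::
  "('k \<Rightarrow> 'g \<Rightarrow> 'g) \<Rightarrow> 'k \<Rightarrow> 'g cochain \<Rightarrow> 'g cochain" where
  "cochain_scale scale c p = ((\<lambda>xs. scale c (fst p xs)), (\<lambda>xs. scale c (snd p xs)))"

definition cochains ::
  "('k::field \<Rightarrow> 'g::ab_group_add \<Rightarrow> 'g) \<Rightarrow> nat \<Rightarrow> 'g cochain set" where
  "cochains scale n =
    (if n = 0 then {0}
     else if n = 1 then Hom_wedge scale 0 \<times> {0}
     else Hom_wedge scale (n - 1) \<times> Hom_wedge scale (n - 2))"

text \<open>
  In degrees 0 and 1 the second component of a cochain is 0, and so is its image under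
  \<open>d_reg\<close>; hence the truncated \<open>n - 1\<close> is harmless.
\<close>

definition D_bar ::
  "('k::field \<Rightarrow> 'g::ab_group_add \<Rightarrow> 'g) \<Rightarrow> ('g \<Rightarrow> 'g \<Rightarrow> 'g) \<Rightarrow> ('g \<Rightarrow> 'g) \<Rightarrow> nat \<Rightarrow>
    'g cochain \<Rightarrow> 'g cochain" where
  "D_bar scale dot D n p =
    (d_reg scale dot n (fst p), d_reg scale dot (n - 1) (snd p) + Omega scale D n (fst p))"

locale cochain_complex = vector_space scale
  for scale :: "'k::field \<Rightarrow> 'v::ab_group_add \<Rightarrow> 'v" +
  fixes C :: "nat \<Rightarrow> 'v set"
    and d :: "nat \<Rightarrow> 'v \<Rightarrow> 'v"
  assumes subspace_C: "module.subspace scale (C n)"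
    and d_closed: "x \<in> C n \<Longrightarrow> d n x \<in> C (Suc n)"
    and d_add: "x \<in> C n \<Longrightarrow> y \<in> C n \<Longrightarrow> d n (x + y) = d n x + d n y"
    and d_scale: "x \<in> C n \<Longrightarrow> d n (scale c x) = scale c (d n x)"
    and d_d: "x \<in> C n \<Longrightarrow> d (Suc n) (d n x) = 0"

definition direct_sum :: "(nat \<Rightarrow> 'v::zero set) \<Rightarrow> (nat \<Rightarrow> 'v) set" where
  "direct_sum C = {c. (\<forall>n. c n \<in> C n) \<and> finite {n. c n \<noteq> 0}}"

definition total_differential ::
  "(nat \<Rightarrow> 'v \<Rightarrow> 'v::zero) \<Rightarrow> (nat \<Rightarrow> 'v) \<Rightarrow> nat \<Rightarrow> 'v" where
  "total_differential d c n = (case n of 0 \<Rightarrow> 0 | Suc m \<Rightarrow> d m (c m))"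

end

theory Submission
  imports Defs
begin

text \<open>
  Singling out the last argument turns a cochain into an alternating map with values in
  Hom(g, g), on which the commutator Lie algebra acts by
  \<open>(x.\<phi>)(z) = x \<cdot> \<phi>(z) + \<phi>(x) \<cdot> z - \<phi>(x \<cdot> z)\<close>; that this is a representation is where
  left symmetry enters. Under this identification \<open>d_reg\<close> is the Chevalley--Eilenberg differential,
  and up to sign \<open>Omega\<close> is the Lie derivative along \<open>D\<close>. With \<open>\<iota>\<^sub>x\<close> denoting insertion
  of \<open>x\<close> as first argument, Cartan's formula \<open>\<iota>\<^sub>x d = L\<^sub>x - d \<iota>\<^sub>x\<close> determines \<open>d\<close> by recursion on
  the argument list. Induction along this recursion shows that \<open>d\<close> commutes with the Lie
  derivatives \<open>L\<^sub>x\<close> and \<open>L\<^sub>D\<close>; with the former,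
  \<open>\<iota>\<^sub>x d d = L\<^sub>x d - d L\<^sub>x + d d \<iota>\<^sub>x\<close> gives \<open>d d = 0\<close>.
\<close>

section \<open>Lie derivatives and the Cartan recursion on functions of lists\<close>

text \<open>Unfolded, this is \<open>B (w xs)\<close> minus the sum of the terms in which
  \<open>A\<close> hits one argument. The second equation is the rule iota_y L = L iota_y - iota_(A
  y), so proofs can peel off arguments from the front.\<close>

primrec lie_der ::
  "('a \<Rightarrow> 'a) \<Rightarrow> ('v \<Rightarrow> 'v) \<Rightarrow> ('a list \<Rightarrow> 'v::ab_group_add) \<Rightarrow> 'a list \<Rightarrow> 'v" where
  "lie_der A B w [] = B (w [])"
| "lie_der A B w (y # ys) = lie_der A B (\<lambda>zs. w (y # zs)) ys - w (A y # ys)"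

text \<open>The second equation is Cartan's formula.\<close>

primrec ce_diff ::
  "('a \<Rightarrow> 'a \<Rightarrow> 'a) \<Rightarrow> ('a \<Rightarrow> 'v \<Rightarrow> 'v) \<Rightarrow> ('a list \<Rightarrow> 'v::ab_group_add) \<Rightarrow> 'a list \<Rightarrow> 'v" where
  "ce_diff br r w [] = 0"
| "ce_diff br r w (x # xs) = lie_der (br x) (r x) w xs - ce_diff br r (\<lambda>zs. w (x # zs)) xs"

lemma lie_der_diff:
  assumes "\<And>u v. B (u - v) = B u - B v"
  shows "lie_der A B (\<lambda>zs. w zs - w' zs) xs = lie_der A B w xs - lie_der A B w' xs"
  by (induction xs arbitrary: w w') (simp_all add: assms)

lemma lie_der_add:
  assumes "\<And>u v. B (u + v) = B u + B v"
  shows "lie_der A B (\<lambda>zs. w zs + w' zs) xs = lie_der A B w xs + lie_der A B w' xs"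
  by (induction xs arbitrary: w w') (simp_all add: assms)

lemma lie_der_zero: "B 0 = 0 \<Longrightarrow> lie_der A B (\<lambda>zs. 0) xs = 0"
  by (induction xs) simp_all

text \<open>Inserting an argument lowers the degree by one, in step with the list; in degree 0 the
  insertion is already the zero map. Together with \<open>ce_diff_degree\<close> this supplies the
  clause of \<open>Hom_wedge\<close> about lists of the wrong length.\<close>

lemma lie_der_degree:
  assumes "B 0 = 0" "\<And>xs. length xs \<noteq> n \<Longrightarrow> w xs = 0" "length xs \<noteq> n"
  shows "lie_der A B w xs = 0"
  using assms(2,3)
proof (induction xs arbitrary: w n)
  case (Cons y ys)
  show ?case
  proof (cases n)
    case 0
    then show ?thesis using Cons.prems by (simp add: lie_der_zero assms(1))
  next
    case (Suc m)
    have "lie_der A B (\<lambda>zs. w (y # zs)) ys = 0"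
      using Cons.prems Suc by (intro Cons.IH[of m]) auto
    then show ?thesis using Cons.prems by simp
  qed
qed (simp add: assms(1))

lemma ce_diff_degree:
  assumes "\<And>x. r x 0 = 0" "\<And>xs. length xs \<noteq> n \<Longrightarrow> w xs = 0" "length xs \<noteq> Suc n"
  shows "ce_diff br r w xs = 0"
  using assms(2,3)
proof (induction xs arbitrary: w n)
  case (Cons y ys)
  have 1: "lie_der (br y) (r y) w ys = 0"
    using Cons.prems assms(1) by (intro lie_der_degree[of _ n]) auto
  show ?case
  proof (cases n)
    case 0
    then have "w (y # zs) = 0" for zs using Cons.prems by simp
    moreover have "ce_diff br r (\<lambda>zs. 0) ys = 0" for ys
      by (induction ys) (simp_all add: lie_der_zero assms(1))
    ultimately show ?thesis using 1 by simp
  next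
    case (Suc m)
    have "ce_diff br r (\<lambda>zs. w (y # zs)) ys = 0"
      using Cons.prems Suc by (intro Cons.IH[of m]) auto
    then show ?thesis using 1 by simp
  qed
qed simp

lemma lie_der_eq_sum:
  "lie_der A B w xs = B (w xs) - (\<Sum>i<length xs. w (xs[i := A (xs ! i)]))"
  by (induction xs arbitrary: w)
    (simp_all add: sum.lessThan_Suc_shift algebra_simps del: sum.lessThan_Suc)

text \<open>Terms in which \<open>A\<close> and \<open>A'\<close> hit different arguments, or one
  hits an argument and the other map acts on the value, cancel. The commutator relations are assumed
  only under \<open>w\<close> and on values of \<open>w\<close>, because the module law will be
  available only on \<open>V\<close>.\<close>

lemma lie_der_commutator:
  assumes B: "\<And>u v. B (u - v) = B u - B v" and B': "\<And>u v. B' (u - v) = B' u - B' v"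
    and A'': "\<And>xs ys y. w (xs @ A (A' y) # ys) - w (xs @ A' (A y) # ys) = w (xs @ A'' y # ys)"
    and B'': "\<And>xs. B (B' (w xs)) - B' (B (w xs)) = B'' (w xs)"
  shows "lie_der A B (lie_der A' B' w) xs - lie_der A' B' (lie_der A B w) xs = lie_der A'' B'' w xs"
  using A'' B''
proof (induction xs arbitrary: w)
  case (Cons y ys)
  have IH: "lie_der A B (lie_der A' B' (\<lambda>zs. w (y # zs))) ys
      - lie_der A' B' (lie_der A B (\<lambda>zs. w (y # zs))) ys = lie_der A'' B'' (\<lambda>zs. w (y # zs)) ys"
  proof (rule Cons.IH)
    show "w (y # xs @ A (A' z) # ys) - w (y # xs @ A' (A z) # ys) = w (y # xs @ A'' z # ys)"
      for xs ys z using Cons.prems(1)[of "y # xs"] by simp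
  qed (rule Cons.prems(2))
  show ?case
    using IH Cons.prems(1)[of "[]" y ys] by (simp add: lie_der_diff B B' algebra_simps)
qed simp

section \<open>Alternating multilinear maps on lists\<close>

text \<open>
  No degree is fixed: a cochain of one degree is extended by 0 to the lists of all other lengths.
\<close>

definition alt_maps ::
  "('k \<Rightarrow> 'a \<Rightarrow> 'a) \<Rightarrow> ('k \<Rightarrow> 'v \<Rightarrow> 'v) \<Rightarrow> 'v set \<Rightarrow> ('a::ab_group_add list \<Rightarrow> 'v::ab_group_add) set" where
  "alt_maps s sv V = {w. (\<forall>xs. w xs \<in> V) \<and>
     (\<forall>as x y bs. w (as @ (x + y) # bs) = w (as @ x # bs) + w (as @ y # bs)) \<and>
     (\<forall>as c x bs. w (as @ s c x # bs) = sv c (w (as @ x # bs))) \<and>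
     (\<forall>as x bs. w (as @ x # x # bs) = 0)}"

lemma alt_mapsI:
  assumes "\<And>xs. w xs \<in> V"
    and "\<And>as x y bs. w (as @ (x + y) # bs) = w (as @ x # bs) + w (as @ y # bs)"
    and "\<And>as c x bs. w (as @ s c x # bs) = sv c (w (as @ x # bs))"
    and "\<And>as x bs. w (as @ x # x # bs) = 0"
  shows "w \<in> alt_maps s sv V"
  using assms by (simp add: alt_maps_def)

lemma alt_mapsD:
  assumes "w \<in> alt_maps s sv V"
  shows "w xs \<in> V"
    and "w (as @ (x + y) # bs) = w (as @ x # bs) + w (as @ y # bs)"
    and "w (as @ s c x # bs) = sv c (w (as @ x # bs))"
    and "w (as @ x # x # bs) = 0"
  using assms by (simp_all add: alt_maps_def)

lemma alt_maps_Cons: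
  assumes "w \<in> alt_maps s sv V"
  shows "(\<lambda>zs. w (x # zs)) \<in> alt_maps s sv V"
  using alt_mapsD[OF assms, of "x # as" for as] alt_mapsD(1)[OF assms]
  by (intro alt_mapsI) simp_all

lemma alt_mapsD_hd:
  assumes "w \<in> alt_maps s sv V"
  shows "w ((x + y) # bs) = w (x # bs) + w (y # bs)"
    and "w (s c x # bs) = sv c (w (x # bs))"
    and "w (x # x # bs) = 0"
  using alt_mapsD(2-)[OF assms, of "[]"] by simp_all

text \<open>Polarization: expand the vanishing value at the repeated argument
  \<open>x + y\<close>.\<close>

lemma alt_maps_swap_hd:
  assumes "w \<in> alt_maps s sv V"
  shows "w (x # y # bs) = - w (y # x # bs)"
proof -
  note h = alt_mapsD_hd[OF assms] and t = alt_mapsD_hd[OF alt_maps_Cons[OF assms]]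
  have "0 = w ((x + y) # (x + y) # bs)" by (simp only: h(3))
  also have "\<dots> = w (x # y # bs) + w (y # x # bs)" by (simp only: h(1) t(1)) (simp add: h(3))
  finally show ?thesis by (metis eq_neg_iff_add_eq_0)
qed

lemma alt_maps_swap:
  assumes "w \<in> alt_maps s sv V"
  shows "w (as @ x # y # bs) = - w (as @ y # x # bs)"
  using assms
proof (induction as arbitrary: w)
  case Nil
  show ?case using alt_maps_swap_hd[OF Nil, of x y bs] by simp
next
  case (Cons a as)
  show ?case using Cons.IH[OF alt_maps_Cons[OF Cons.prems, of a]] by (simp only: append_Cons)
qed

text \<open>\<open>alt_maps\<close> speaks only of adjacent equal arguments,
  \<open>Hom_wedge\<close> of arbitrary positions. Transpositions carry the first of the equal
  entries to the right, up to sign, until it meets the second.\<close>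

lemma alt_maps_eq_0:
  assumes w: "w \<in> alt_maps s sv V" and ij: "i < j" "j < length xs" "xs ! i = xs ! j"
  shows "w xs = 0"
proof -
  have *: "w (as @ x # bs @ x # cs) = 0" for as x bs cs
  proof (induction bs arbitrary: as)
    case Nil
    show ?case by (simp add: alt_mapsD(4)[OF w])
  next
    case (Cons b bs)
    show ?case using Cons[of "as @ [b]"] by (simp add: alt_maps_swap[OF w, of _ x b])
  qed
  define x where "x = xs ! i"
  define ys where "ys = drop (Suc i) xs"
  have j: "j - Suc i < length ys" "ys ! (j - Suc i) = x" using ij by (simp_all add: ys_def x_def)
  have xs: "take i xs @ x # ys = xs" unfolding ys_def x_def using ij by (intro id_take_nth_drop[symmetric]) simp
  have ys: "take (j - Suc i) ys @ x # drop (Suc (j - Suc i)) ys = ys"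
    using id_take_nth_drop[OF j(1), symmetric] j(2) by simp
  show ?thesis
    using *[of "take i xs" x "take (j - Suc i) ys" "drop (Suc (j - Suc i)) ys"] by (simp only: ys xs)
qed

lemma nths_UNIV: "nths xs UNIV = xs"
  by (simp add: nths_all)

section \<open>Cartan calculus for a Lie algebra module\<close>

text \<open>The module is a subspace \<open>V\<close> of the type \<open>'v\<close>, since the
  intended module is the set of linear maps inside all functions. Laws that need linearity of the
  module element are restricted to \<open>V\<close>; linearity of \<open>r x\<close> itself is not,
  so \<open>d\<close> is linear on arbitrary functions.\<close>

locale lie_algebra_module =
  L: vector_space scale + M: vector_space sv
  for scale :: "'k::field \<Rightarrow> 'a::ab_group_add \<Rightarrow> 'a"
    and sv :: "'k \<Rightarrow> 'v::ab_group_add \<Rightarrow> 'v" +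
  fixes br :: "'a \<Rightarrow> 'a \<Rightarrow> 'a" and r :: "'a \<Rightarrow> 'v \<Rightarrow> 'v" and V :: "'v set"
  assumes br_add: "br (x + y) z = br x z + br y z" "br x (y + z) = br x y + br x z"
    and br_scale: "br (scale c x) z = scale c (br x z)" "br x (scale c z) = scale c (br x z)"
    and br_self: "br x x = 0"
    and jacobi: "br x (br y z) - br y (br x z) = br (br x y) z"
    and V_subspace: "M.subspace V"
    and r_closed: "v \<in> V \<Longrightarrow> r x v \<in> V"
    and r_add: "r x (u + v) = r x u + r x v"
    and r_scale: "r x (sv c v) = sv c (r x v)"
    and r_add_left: "v \<in> V \<Longrightarrow> r (x + y) v = r x v + r y v"
    and r_scale_left: "v \<in> V \<Longrightarrow> r (scale c x) v = sv c (r x v)"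
    and r_br: "v \<in> V \<Longrightarrow> r x (r y v) - r y (r x v) = r (br x y) v"
begin

abbreviation "alt \<equiv> alt_maps scale sv V"
abbreviation "Lie x \<equiv> lie_der (br x) (r x)"
abbreviation "d \<equiv> ce_diff br r"

lemma r_zero [simp]: "r x 0 = 0"
  using r_add[of x 0 0] by simp

lemma r_diff: "r x (u - v) = r x u - r x v"
  using r_add[of x "u - v" v] by (simp add: algebra_simps)

lemma d_zero [simp]: "d (\<lambda>zs. 0) xs = 0"
  by (induction xs) (simp_all add: lie_der_zero)

lemma d_add: "d (\<lambda>zs. w zs + w' zs) xs = d w xs + d w' xs"
  by (induction xs arbitrary: w w') (simp_all add: lie_der_add r_add)

lemma lie_der_scale:
  assumes "\<And>c v. B (sv c v) = sv c (B v)"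
  shows "lie_der A B (\<lambda>zs. sv c (w zs)) xs = sv c (lie_der A B w xs)"
  by (induction xs arbitrary: w) (simp_all add: assms M.scale_right_diff_distrib)

lemma d_scale: "d (\<lambda>zs. sv c (w zs)) xs = sv c (d w xs)"
  by (induction xs arbitrary: w) (simp_all add: lie_der_scale r_scale M.scale_right_diff_distrib)

lemma d_diff: "d (\<lambda>zs. w zs - w' zs) xs = d w xs - d w' xs"
  by (induction xs arbitrary: w w') (simp_all add: lie_der_diff r_diff)

text \<open>Keeping \<open>A\<close> and \<open>B\<close> general lets one lemma serve both the Lie
  derivative along an element and the one along \<open>D\<close>.\<close>

lemma lie_der_alt:
  assumes A: "\<And>x y. A (x + y) = A x + A y" "\<And>c x. A (scale c x) = scale c (A x)"
    and B: "\<And>u v. B (u + v) = B u + B v" "\<And>c v. B (sv c v) = sv c (B v)"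
      "\<And>v. v \<in> V \<Longrightarrow> B v \<in> V"
    and w: "w \<in> alt"
  shows "lie_der A B w \<in> alt"
proof (rule alt_mapsI)
  show "lie_der A B w xs \<in> V" for xs
    using w
  proof (induction xs arbitrary: w)
    case (Cons x xs)
    show ?case
      using Cons.IH[OF alt_maps_Cons[OF Cons.prems, of x]] alt_mapsD(1)[OF Cons.prems, of "A x # xs"]
      by (simp add: M.subspace_diff[OF V_subspace])
  next
    case Nil
    show ?case by (simp add: alt_mapsD(1)[OF Nil] B(3))
  qed
  show "lie_der A B w (as @ (x + y) # bs) = lie_der A B w (as @ x # bs) + lie_der A B w (as @ y # bs)"
    for as x y bs
    using w
  proof (induction as arbitrary: w)
    case Nil
    show ?case by (simp add: A alt_mapsD_hd(1)[OF Nil] lie_der_add[OF B(1)] algebra_simps)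
  next
    case (Cons a as)
    show ?case
      using Cons.IH[OF alt_maps_Cons[OF Cons.prems, of a]] alt_mapsD(2)[OF Cons.prems, of "A a # as" x y bs]
      by (simp add: algebra_simps)
  qed
  show "lie_der A B w (as @ scale c x # bs) = sv c (lie_der A B w (as @ x # bs))"
    for as c x bs
    using w
  proof (induction as arbitrary: w)
    case Nil
    show ?case by (simp add: A alt_mapsD_hd(2)[OF Nil] lie_der_scale[OF B(2)] M.scale_right_diff_distrib)
  next
    case (Cons a as)
    show ?case
      using Cons.IH[OF alt_maps_Cons[OF Cons.prems, of a]] alt_mapsD(3)[OF Cons.prems, of "A a # as" c x bs]
      by (simp add: M.scale_right_diff_distrib)
  qed
  have B0: "B 0 = 0" using B(1)[of 0 0] by simp
  show "lie_der A B w (as @ x # x # bs) = 0" for as x bs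
    using w
  proof (induction as arbitrary: w)
    case Nil
    \<comment> \<open>The two terms in which \<open>A\<close> hits one of the equal arguments cancel
      by antisymmetry; every other term still has the repetition.\<close>
    show ?case
      using alt_maps_swap_hd[OF Nil, of x "A x" bs]
      by (simp add: alt_mapsD_hd(3)[OF Nil] lie_der_zero[of B, OF B0])
  next
    case (Cons a as)
    show ?case
      using Cons.IH[OF alt_maps_Cons[OF Cons.prems, of a]] alt_mapsD(4)[OF Cons.prems, of "A a # as" x bs]
      by simp
  qed
qed

lemma Lie_alt: "w \<in> alt \<Longrightarrow> Lie x w \<in> alt"
  by (rule lie_der_alt) (simp_all add: br_add br_scale r_add r_scale r_closed)

lemma Lie_add_left: "w \<in> alt \<Longrightarrow> Lie (x + y) w xs = Lie x w xs + Lie y w xs"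
proof (induction xs arbitrary: w)
  case (Cons a xs)
  show ?case
    using Cons.IH[OF alt_maps_Cons[OF Cons.prems, of a]] alt_mapsD_hd(1)[OF Cons.prems, of "br x a" "br y a" xs]
    by (simp add: br_add algebra_simps)
next
  case Nil
  show ?case by (simp add: r_add_left alt_mapsD(1)[OF Nil])
qed

lemma Lie_scale_left: "w \<in> alt \<Longrightarrow> Lie (scale c x) w xs = sv c (Lie x w xs)"
proof (induction xs arbitrary: w)
  case (Cons a xs)
  show ?case
    using Cons.IH[OF alt_maps_Cons[OF Cons.prems, of a]] alt_mapsD_hd(2)[OF Cons.prems, of c "br x a" xs]
    by (simp add: br_scale M.scale_right_diff_distrib)
next
  case Nil
  show ?case by (simp add: r_scale_left alt_mapsD(1)[OF Nil])
qed

lemma d_alt: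
  assumes w: "w \<in> alt"
  shows "d w \<in> alt"
proof (rule alt_mapsI)
  show "d w xs \<in> V" for xs
    using w
  proof (induction xs arbitrary: w)
    case (Cons x xs)
    show ?case
      using Cons.IH[OF alt_maps_Cons[OF Cons.prems, of x]] alt_mapsD(1)[OF Lie_alt[OF Cons.prems], of x xs]
      by (simp add: M.subspace_diff[OF V_subspace])
  qed (simp add: M.subspace_0[OF V_subspace])
  show "d w (as @ (x + y) # bs) = d w (as @ x # bs) + d w (as @ y # bs)" for as x y bs
    using w
  proof (induction as arbitrary: w)
    case Nil
    show ?case
      by (simp add: Lie_add_left[OF Nil] alt_mapsD_hd(1)[OF Nil] d_add)
  next
    case (Cons a as)
    show ?case
      using Cons.IH[OF alt_maps_Cons[OF Cons.prems, of a]] alt_mapsD(2)[OF Lie_alt[OF Cons.prems], of a as x y bs]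
      by (simp add: algebra_simps)
  qed
  show "d w (as @ scale c x # bs) = sv c (d w (as @ x # bs))" for as c x bs
    using w
  proof (induction as arbitrary: w)
    case Nil
    show ?case
      by (simp add: Lie_scale_left[OF Nil] alt_mapsD_hd(2)[OF Nil] d_scale M.scale_right_diff_distrib)
  next
    case (Cons a as)
    show ?case
      using Cons.IH[OF alt_maps_Cons[OF Cons.prems, of a]] alt_mapsD(3)[OF Lie_alt[OF Cons.prems], of a as c x bs]
      by (simp add: M.scale_right_diff_distrib)
  qed
  show "d w (as @ x # x # bs) = 0" for as x bs
    using w
  proof (induction as arbitrary: w)
    case Nil
    \<comment> \<open>Unfolding Cartan's formula twice, the two copies of the Lie derivative of the
      insertion cancel. What is left is \<open>d\<close> of a doubly inserted \<open>x\<close> and a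
      term with first argument [x, x] = 0.\<close>
    have "w (0 # bs) = 0" for bs
      using alt_mapsD_hd(2)[OF Nil, of 0 0] by simp
    then show ?case
      by (simp add: alt_mapsD_hd(3)[OF Nil] br_self)
  next
    case (Cons a as)
    show ?case
      using Cons.IH[OF alt_maps_Cons[OF Cons.prems, of a]] alt_mapsD(4)[OF Lie_alt[OF Cons.prems], of a as x bs]
      by simp
  qed
qed

text \<open>The hypotheses say that (A, B) is a derivation of the Lie algebra and its module, so
  that [L, Lie y] = Lie (A y). After insertion of \<open>y\<close> this cancels the extra term from
  iota_(A y) d, and induction handles d iota_y. For \<open>br x\<close> and \<open>r x\<close> the
  hypotheses are Jacobi and the module law.\<close>

lemma lie_der_d:
  assumes w: "w \<in> alt"
    and A_br: "\<And>x y. A (br x y) = br (A x) y + br x (A y)"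
    and B_add: "\<And>u v. B (u + v) = B u + B v"
    and B_r: "\<And>x v. v \<in> V \<Longrightarrow> B (r x v) = r (A x) v + r x (B v)"
  shows "lie_der A B (d w) xs = d (lie_der A B w) xs"
  using w
proof (induction xs arbitrary: w)
  case Nil
  show ?case using B_add[of 0 0] by simp
next
  case (Cons y ys)
  have B_diff: "B (u - v) = B u - B v" for u v
    using B_add[of "u - v" v] by (simp add: algebra_simps)
  have "lie_der A B (Lie y w) ys - Lie y (lie_der A B w) ys = Lie (A y) w ys"
  proof (rule lie_der_commutator)
    show "w (xs @ A (br y z) # zs) - w (xs @ br y (A z) # zs) = w (xs @ br (A y) z # zs)"
      for xs zs z
      by (simp add: A_br alt_mapsD(2)[OF Cons.prems])
    show "B (r y (w xs)) - r y (B (w xs)) = r (A y) (w xs)" for xs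
      by (simp add: B_r alt_mapsD(1)[OF Cons.prems])
  qed (simp_all add: B_diff r_diff)
  then show ?case
    using Cons.IH[OF alt_maps_Cons[OF Cons.prems, of y]]
    by (simp add: lie_der_diff[OF B_diff] d_diff algebra_simps)
qed

lemma Lie_d: "w \<in> alt \<Longrightarrow> Lie x (d w) xs = d (Lie x w) xs"
  by (rule lie_der_d) (simp_all add: r_add jacobi[symmetric] r_br[symmetric])

lemma d_d: "w \<in> alt \<Longrightarrow> d (d w) xs = 0"
proof (induction xs arbitrary: w)
  case (Cons x xs)
  show ?case
    using Cons.IH[OF alt_maps_Cons[OF Cons.prems, of x]] by (simp add: Lie_d[OF Cons.prems] d_diff)
qed simp

text \<open>The sign comes from moving the changed entry back past its \<open>i\<close>
  predecessors. This turns the brackets with the head of a list in \<open>d_eq_sum\<close> into the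
  argument terms of a Lie derivative.\<close>

lemma sum_move_front:
  assumes w: "w \<in> alt"
  shows "(\<Sum>i<length xs. sv ((-1) ^ i) (w (A (xs ! i) # nths xs (- {i}))))
    = (\<Sum>i<length xs. w (xs[i := A (xs ! i)]))"
  using w
proof (induction xs arbitrary: w)
  case (Cons y ys)
  have nths: "nths (y # ys) (- {0}) = ys" "nths (y # ys) (- {Suc i}) = y # nths ys (- {i})" for i
    by (simp_all add: nths_Cons Compl_eq nths_UNIV)
  show ?case
    using Cons.IH[OF alt_maps_Cons[OF Cons.prems, of y]]
    by (simp add: sum.lessThan_Suc_shift nths alt_maps_swap_hd[OF Cons.prems, of _ y]
        del: sum.lessThan_Suc)
qed simp

text \<open>For a list with head \<open>y\<close>, the term acting by \<open>y\<close> and the pairs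
  containing position 0 assemble into \<open>Lie y w\<close>. The remaining terms form
  \<open>- d\<close> of the insertion: the action sum gets its sign from the index shift, the pair
  sum from swapping the bracket with \<open>y\<close>.\<close>

lemma d_eq_sum:
  assumes w: "w \<in> alt"
  shows "d w xs = (\<Sum>i<length xs. sv ((-1) ^ i) (r (xs ! i) (w (nths xs (- {i})))))
    + (\<Sum>j<length xs. \<Sum>i<j. sv ((-1) ^ (i + j)) (w (br (xs ! i) (xs ! j) # nths xs (- {i, j}))))"
  using w
proof (induction xs arbitrary: w)
  case (Cons y ys)
  have nths: "nths (y # ys) (- {0}) = ys" "nths (y # ys) (- {Suc i}) = y # nths ys (- {i})"
    "nths (y # ys) (- {0, Suc i}) = nths ys (- {i})"
    "nths (y # ys) (- {Suc i, Suc j}) = y # nths ys (- {i, j})" for i j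
    by (simp_all add: nths_Cons Compl_eq nths_UNIV)
  show ?case
    using Cons.IH[OF alt_maps_Cons[OF Cons.prems, of y]] sum_move_front[OF Cons.prems, of "br y" ys]
    by (simp add: sum.lessThan_Suc_shift nths alt_maps_swap_hd[OF Cons.prems, of _ y]
        lie_der_eq_sum sum.distrib sum_subtractf sum_negf del: sum.lessThan_Suc)
qed simp

end


section \<open>The module Hom(g, g) and currying of the last argument\<close>

definition hom_scale :: "('k \<Rightarrow> 'g \<Rightarrow> 'g) \<Rightarrow> 'k \<Rightarrow> ('g \<Rightarrow> 'g) \<Rightarrow> 'g \<Rightarrow> 'g" where
  "hom_scale s c p = (\<lambda>z. s c (p z))"

definition hom_act :: "('g \<Rightarrow> 'g \<Rightarrow> 'g) \<Rightarrow> 'g \<Rightarrow> ('g \<Rightarrow> 'g) \<Rightarrow> 'g \<Rightarrow> 'g::ab_group_add" where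
  "hom_act dt x p = (\<lambda>z. dt x (p z) + dt (p x) z - p (dt x z))"

text \<open>The commutator of \<open>D\<close> with \<open>p\<close>. Its term
  \<open>- p (D z)\<close> accounts for \<open>D\<close> hitting the last argument, which currying
  hides from \<open>lie_der\<close>.\<close>

definition hom_der :: "('g \<Rightarrow> 'g) \<Rightarrow> ('g \<Rightarrow> 'g) \<Rightarrow> 'g \<Rightarrow> 'g::ab_group_add" where
  "hom_der D p = (\<lambda>z. D (p z) - p (D z))"

definition curry_last :: "('g list \<Rightarrow> 'g) \<Rightarrow> 'g list \<Rightarrow> 'g \<Rightarrow> 'g" where
  "curry_last f xs z = f (xs @ [z])"

text \<open>The value at \<open>[]\<close> is forced: \<open>Hom_wedge\<close> demands 0 on lists of
  the wrong length, and no member takes zero arguments.\<close>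

definition uncurry_last :: "('g list \<Rightarrow> 'g \<Rightarrow> 'g) \<Rightarrow> 'g list \<Rightarrow> 'g::zero" where
  "uncurry_last w xs = (if xs = [] then 0 else w (butlast xs) (last xs))"

lemma curry_uncurry [simp]: "curry_last (uncurry_last w) = w"
  by (intro ext) (simp add: curry_last_def uncurry_last_def)

lemma sum_fun_apply: "(\<Sum>i\<in>A. p i) z = (\<Sum>i\<in>A. p i z)"
  by (induction A rule: infinite_finite_induct) simp_all

section \<open>From pre-Lie cochains to Chevalley--Eilenberg cochains\<close>

context pre_lie_algebra
begin

abbreviation "linmaps \<equiv> {p. Vector_Spaces.linear scale scale p}"

lemma linear_iff:
  "Vector_Spaces.linear scale scale p \<longleftrightarrow> (\<forall>x y. p (x + y) = p x + p y) \<and> (\<forall>c x. p (scale c x) = scale c (p x))"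
  by (auto simp: Vector_Spaces.linear_def module_hom_def module_hom_axioms_def vector_space_axioms
      module_axioms)

lemma dot_simps:
  "dot (x + y) z = dot x z + dot y z" "dot x (y + z) = dot x y + dot x z"
  "dot (scale c x) z = scale c (dot x z)" "dot x (scale c z) = scale c (dot x z)"
  "dot (x - y) z = dot x z - dot y z" "dot x (y - z) = dot x y - dot x z"
  "dot (- x) z = - dot x z" "dot x (- z) = - dot x z"
  "dot 0 z = 0" "dot x 0 = 0"
proof -
  show add: "dot (x + y) z = dot x z + dot y z" "dot x (y + z) = dot x y + dot x z" for x y z
    using dot_linear_left[of z] dot_linear_right[of x] by (simp_all add: linear_iff)
  show "dot (scale c x) z = scale c (dot x z)" "dot x (scale c z) = scale c (dot x z)"
    using dot_linear_left[of z] dot_linear_right[of x] by (simp_all add: linear_iff)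
  show zero: "dot 0 z = 0" "dot x 0 = 0" for x z
    using add(1)[of 0 0 z] add(2)[of x 0 0] by simp_all
  show neg: "dot (- x) z = - dot x z" "dot x (- z) = - dot x z" for x z
    using add(1)[of x "- x" z] add(2)[of x z "- z"] zero
    by (simp_all add: eq_neg_iff_add_eq_0 add.commute)
  show "dot (x - y) z = dot x z - dot y z" "dot x (y - z) = dot x y - dot x z"
    using add(1)[of x "- y" z] add(2)[of x y "- z"] neg by simp_all
qed

text \<open>Solved for one product so that chosen instances can rewrite; in general form it would
  loop, as \<open>dot (dot y x) z\<close> reappears on the right.\<close>

lemma left_symmetric':
  "dot (dot x y) z = dot x (dot y z) + dot (dot y x) z - dot y (dot x z)"
  using left_symmetric[of x y z] by (simp add: algebra_simps)

lemma linear_additive: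
  assumes "Vector_Spaces.linear scale scale p"
  shows "p (x + y) = p x + p y" "p (x - y) = p x - p y" "p (scale c x) = scale c (p x)" "p 0 = 0"
proof -
  show add: "p (x + y) = p x + p y" for x y using assms by (simp add: linear_iff)
  show "p (scale c x) = scale c (p x)" using assms by (simp add: linear_iff)
  show "p 0 = 0" using add[of 0 0] by simp
  show "p (x - y) = p x - p y" using add[of "x - y" y] by (simp add: algebra_simps)
qed

lemma CE_module:
  "lie_algebra_module scale (hom_scale scale) (comm_bracket dot) (hom_act dot) linmaps"
proof (intro lie_algebra_module.intro lie_algebra_module_axioms.intro)
  show vs: "vector_space (hom_scale scale)"
    by unfold_locales
      (simp_all add: hom_scale_def fun_eq_iff scale_right_distrib scale_left_distrib)
  interpret M: vector_space "hom_scale scale" by (rule vs)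
  show "vector_space scale" by (rule vector_space_axioms)
  show "M.subspace linmaps"
    by (auto simp: M.subspace_def linear_iff hom_scale_def scale_right_distrib scale_left_commute add_ac)
next
  fix x y z :: 'g and c :: 'k
  show "comm_bracket dot (x + y) z = comm_bracket dot x z + comm_bracket dot y z"
    "comm_bracket dot x (y + z) = comm_bracket dot x y + comm_bracket dot x z"
    "comm_bracket dot (scale c x) z = scale c (comm_bracket dot x z)"
    "comm_bracket dot x (scale c z) = scale c (comm_bracket dot x z)"
    "comm_bracket dot x x = 0"
    by (simp_all add: comm_bracket_def dot_simps scale_right_diff_distrib)
  show "comm_bracket dot x (comm_bracket dot y z) - comm_bracket dot y (comm_bracket dot x z)
      = comm_bracket dot (comm_bracket dot x y) z"
    by (simp add: comm_bracket_def dot_simps left_symmetric'[of x y z] left_symmetric'[of y z x]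
        left_symmetric'[of x z y])
next
  fix x :: 'g and c :: 'k and u v :: "'g \<Rightarrow> 'g"
  show "hom_act dot x (u + v) = hom_act dot x u + hom_act dot x v"
    "hom_act dot x (hom_scale scale c v) = hom_scale scale c (hom_act dot x v)"
    by (simp_all add: hom_act_def hom_scale_def fun_eq_iff dot_simps scale_right_distrib
        scale_right_diff_distrib)
next
  fix x y :: 'g and c :: 'k and v :: "'g \<Rightarrow> 'g"
  assume v: "v \<in> linmaps"
  then have v_simps: "v (x + y) = v x + v y" "v (x - y) = v x - v y" "v (scale c x) = scale c (v x)" for x y c
    by (simp_all add: linear_additive)
  show "hom_act dot x v \<in> linmaps"
    by (simp add: linear_iff hom_act_def v_simps dot_simps scale_right_distrib scale_right_diff_distrib)
  show "hom_act dot (x + y) v = hom_act dot x v + hom_act dot y v"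
    "hom_act dot (scale c x) v = hom_scale scale c (hom_act dot x v)"
    by (simp_all add: hom_act_def hom_scale_def fun_eq_iff dot_simps v_simps scale_right_distrib
        scale_right_diff_distrib)
  show "hom_act dot x (hom_act dot y v) - hom_act dot y (hom_act dot x v) = hom_act dot (comm_bracket dot x y) v"
  proof
    fix z
    \<comment> \<open>Left symmetry at (x, v y, z) and (y, v x, z) removes the products of
      \<open>v y\<close> and \<open>v x\<close> with the other elements. At (x, y, v z), and at (x,
      y, z) under \<open>v\<close>, it yields the action of the bracket; terms such as x . v(y . z)
      are symmetric in \<open>x\<close> and \<open>y\<close> and cancel.\<close>
    show "(hom_act dot x (hom_act dot y v) - hom_act dot y (hom_act dot x v)) z
        = hom_act dot (comm_bracket dot x y) v z"
      by (simp add: hom_act_def comm_bracket_def dot_simps v_simps left_symmetric'[of x y "v z"]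
          left_symmetric'[of x "v y" z] left_symmetric'[of y "v x" z] left_symmetric'[of x y z])
  qed
qed

sublocale CE: lie_algebra_module scale "hom_scale scale" "comm_bracket dot" "hom_act dot" linmaps
  by (rule CE_module)

text \<open>Values in \<open>linmaps\<close> encode linearity in the last argument, membership in
  \<open>CE.alt\<close> the conditions on the others. The condition at \<open>[]\<close> is separate
  because \<open>curry_last f\<close> never evaluates \<open>f\<close> there.\<close>

lemma Hom_wedge_iff:
  "f \<in> Hom_wedge scale m \<longleftrightarrow>
    curry_last f \<in> CE.alt \<and> (\<forall>ys. length ys \<noteq> m \<longrightarrow> curry_last f ys = 0) \<and> f [] = 0"
proof
  assume f: "f \<in> Hom_wedge scale m"
  have lin: "Vector_Spaces.linear scale scale (\<lambda>v. f (as @ v # bs))" for as bs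
  proof (cases "length as + length bs = m")
    case True
    have "\<forall>xs i. length xs = m + 1 \<longrightarrow> i < m + 1 \<longrightarrow>
        Vector_Spaces.linear scale scale (\<lambda>v. f (xs[i := v]))"
      using f by (simp add: Hom_wedge_def)
    \<comment> \<open>The entry 0 is a placeholder that the update overwrites.\<close>
    from this[rule_format, of "as @ 0 # bs" "length as"] True show ?thesis by simp
  next
    case False
    then have "f (as @ v # bs) = 0" for v using f by (simp add: Hom_wedge_def)
    then show ?thesis by (simp add: linear_iff)
  qed
  have alt: "f (as @ x # x # bs @ [z]) = 0" for as x bs z
  proof (cases "length as + length bs + 2 = m")
    case True
    have "\<forall>xs i j. length xs = m + 1 \<longrightarrow> i < j \<longrightarrow> j < m \<longrightarrow> xs ! i = xs ! j \<longrightarrow> f xs = 0"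
      using f by (simp add: Hom_wedge_def)
    from this[rule_format, of "as @ x # x # bs @ [z]" "length as" "Suc (length as)"] True
    show ?thesis by (simp add: nth_append)
  next
    case False
    then show ?thesis using f by (simp add: Hom_wedge_def)
  qed
  have "curry_last f \<in> CE.alt"
  proof (rule alt_mapsI)
    show "curry_last f xs \<in> linmaps" for xs using lin[of xs "[]"] by (simp add: curry_last_def[abs_def])
    fix as x y bs c
    show "curry_last f (as @ (x + y) # bs) = curry_last f (as @ x # bs) + curry_last f (as @ y # bs)"
      "curry_last f (as @ scale c x # bs) = hom_scale scale c (curry_last f (as @ x # bs))"
      "curry_last f (as @ x # x # bs) = 0"
      using linear_additive(1,3)[OF lin[of as "bs @ [z]" for z]] alt[of as x bs]
      by (simp_all add: curry_last_def fun_eq_iff hom_scale_def)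
  qed
  then show "curry_last f \<in> CE.alt \<and> (\<forall>ys. length ys \<noteq> m \<longrightarrow> curry_last f ys = 0) \<and> f [] = 0"
    using f by (simp add: Hom_wedge_def curry_last_def fun_eq_iff)
next
  assume "curry_last f \<in> CE.alt \<and> (\<forall>ys. length ys \<noteq> m \<longrightarrow> curry_last f ys = 0) \<and> f [] = 0"
  then have w: "curry_last f \<in> CE.alt" and deg: "\<And>ys. length ys \<noteq> m \<Longrightarrow> curry_last f ys = 0"
    and 0: "f [] = 0" by auto
  have snoc: "f (ys @ [z]) = curry_last f ys z"
    "f (as @ v # bs @ [z]) = curry_last f (as @ v # bs) z" for ys as bs v z
    by (simp_all add: curry_last_def)
  have decomp: "\<exists>ys z. xs = ys @ [z] \<and> length ys = m" if "length xs = m + 1" for xs :: "'g list"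
    using that by (cases xs rule: rev_cases) auto
  have "Vector_Spaces.linear scale scale (\<lambda>v. f (xs[i := v]))"
    if xs: "length xs = m + 1" and i: "i < m + 1" for xs i
  proof -
    obtain ys z where ys: "xs = ys @ [z]" "length ys = m" using decomp[OF xs] by blast
    show ?thesis
    \<comment> \<open>Position \<open>m\<close> holds the argument split off by currying, so
      linearity there is linearity of the value of \<open>curry_last f\<close>.\<close>
    proof (cases "i = m")
      case True
      then show ?thesis
        using ys alt_mapsD(1)[OF w, of ys] by (simp add: list_update_append snoc)
    next
      case False
      then have "ys[i := v] = take i ys @ v # drop (Suc i) ys" for v
        using i ys by (simp add: upd_conv_take_nth_drop)
      then show ?thesis
        using False i ys
        by (simp add: list_update_append snoc linear_iff alt_mapsD(2,3)[OF w] hom_scale_def)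
    qed
  qed
  moreover have "f xs = 0" if len: "length xs = m + 1" and ij: "i < j" "j < m" "xs ! i = xs ! j" for xs i j
  proof -
    obtain ys z where ys: "xs = ys @ [z]" "length ys = m" using decomp[OF len] by blast
    show ?thesis
      using ij ys alt_maps_eq_0[OF w, of i j ys] by (simp add: nth_append snoc)
  qed
  moreover have "f xs = 0" if "length xs \<noteq> m + 1" for xs
    using that 0 deg by (cases xs rule: rev_cases) (auto simp: snoc)
  ultimately show "f \<in> Hom_wedge scale m" by (simp add: Hom_wedge_def)
qed

lemma Hom_wedgeD:
  assumes "f \<in> Hom_wedge scale m"
  shows "curry_last f \<in> CE.alt" "length ys \<noteq> m \<Longrightarrow> curry_last f ys = 0" "f [] = 0"
  using assms by (simp_all add: Hom_wedge_iff)

lemma uncurry_Hom_wedge: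
  assumes "w \<in> CE.alt" "\<And>ys. length ys \<noteq> m \<Longrightarrow> w ys = 0"
  shows "uncurry_last w \<in> Hom_wedge scale m"
  using assms by (simp add: Hom_wedge_iff) (simp add: uncurry_last_def)

text \<open>By \<open>d_eq_sum\<close>, the first three sums of \<open>d_reg\<close> are the three
  terms of \<open>hom_act\<close> at the last argument, and the fourth is the bracket sum. The index
  is \<open>Suc m\<close> because \<open>d_reg\<close> counts the last argument too.\<close>

lemma d_reg_eq_CE:
  assumes f: "f \<in> Hom_wedge scale m"
  shows "d_reg scale dot (Suc m) f = uncurry_last (CE.d (curry_last f))"
proof
  fix xs
  show "d_reg scale dot (Suc m) f xs = uncurry_last (CE.d (curry_last f)) xs"
  proof (cases "length xs = m + 2")
    case True
    then obtain ys z where xs: "xs = ys @ [z]" and ys: "length ys = Suc m"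
      by (cases xs rule: rev_cases) auto
    have nths: "nths (ys @ [z]) (- {i}) = nths ys (- {i}) @ [z]"
      "nths (ys @ [z]) (- {i, j}) = nths ys (- {i, j}) @ [z]" if "i < Suc m" "j < Suc m" for i j
      using that ys by (simp_all add: nths_append)
    show ?thesis
      unfolding xs
      by (simp add: d_reg_def uncurry_last_def ys CE.d_eq_sum[OF Hom_wedgeD(1)[OF f]] sum_fun_apply
          hom_scale_def hom_act_def curry_last_def nth_append nths sum.distrib sum_subtractf
          scale_right_distrib scale_right_diff_distrib algebra_simps del: sum.lessThan_Suc)
  next
    case False
    then show ?thesis
      using ce_diff_degree[of "hom_act dot" m "curry_last f" "butlast xs"] Hom_wedgeD(2)[OF f]
      by (auto simp: d_reg_def uncurry_last_def)
  qed
qed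

lemma d_reg_Hom_wedge:
  assumes f: "f \<in> Hom_wedge scale m"
  shows "d_reg scale dot (Suc m) f \<in> Hom_wedge scale (Suc m)"
  unfolding d_reg_eq_CE[OF f]
  using Hom_wedgeD[OF f] by (intro uncurry_Hom_wedge CE.d_alt ce_diff_degree[of _ m]) auto

lemma d_reg_d_reg:
  assumes f: "f \<in> Hom_wedge scale m"
  shows "d_reg scale dot (Suc (Suc m)) (d_reg scale dot (Suc m) f) = 0"
proof
  fix xs
  show "d_reg scale dot (Suc (Suc m)) (d_reg scale dot (Suc m) f) xs = 0 xs"
    by (simp add: d_reg_eq_CE[OF d_reg_Hom_wedge[OF f]])
      (simp add: d_reg_eq_CE[OF f] uncurry_last_def CE.d_d[OF Hom_wedgeD(1)[OF f]])
qed

lemma d_reg_add: "d_reg scale dot n (f + g) = d_reg scale dot n f + d_reg scale dot n g"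
  by (rule ext) (simp add: d_reg_def dot_simps scale_right_distrib sum.distrib)

lemma d_reg_scale: "d_reg scale dot n (\<lambda>xs. scale c (f xs)) = (\<lambda>xs. scale c (d_reg scale dot n f xs))"
  by (rule ext) (simp add: d_reg_def dot_simps scale_right_distrib scale_right_diff_distrib
      scale_sum_right mult.commute)

lemma d_reg_0 [simp]: "d_reg scale dot n 0 = 0"
  by (rule ext) (simp add: d_reg_def dot_simps)

lemma Hom_wedge_zero: "0 \<in> Hom_wedge scale m"
  by (simp add: Hom_wedge_def linear_iff)

lemma Hom_wedge_add: "f \<in> Hom_wedge scale m \<Longrightarrow> g \<in> Hom_wedge scale m \<Longrightarrow> f + g \<in> Hom_wedge scale m"
  by (simp add: Hom_wedge_def linear_iff scale_right_distrib)

lemma Hom_wedge_scale: "f \<in> Hom_wedge scale m \<Longrightarrow> (\<lambda>xs. scale c (f xs)) \<in> Hom_wedge scale m"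
  by (simp add: Hom_wedge_def linear_iff scale_right_distrib scale_left_commute)

end

lemma vector_space_cochain_scale:
  assumes "vector_space scale"
  shows "vector_space (cochain_scale scale)"
proof -
  interpret vector_space scale by (rule assms)
  show ?thesis
    by unfold_locales
      (simp_all add: cochain_scale_def fun_eq_iff prod_eq_iff scale_right_distrib scale_left_distrib)
qed

section \<open>The derivation D and the operator Omega\<close>

context regular_pre_LieDer_pair
begin

lemmas D_simps = linear_additive[OF D_linear]

lemma hom_der_simps:
  "hom_der D (u + v) = hom_der D u + hom_der D v"
  "hom_der D (hom_scale scale c u) = hom_scale scale c (hom_der D u)"
  by (simp_all add: hom_der_def hom_scale_def fun_eq_iff D_simps scale_right_diff_distrib)

lemma lie_der_D_alt: "w \<in> CE.alt \<Longrightarrow> lie_der D (hom_der D) w \<in> CE.alt"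
  by (rule CE.lie_der_alt)
    (simp_all add: D_simps hom_der_simps,
      simp add: linear_iff hom_der_def D_simps scale_right_diff_distrib)

lemma lie_der_D_d:
  assumes w: "w \<in> CE.alt"
  shows "lie_der D (hom_der D) (CE.d w) xs = CE.d (lie_der D (hom_der D) w) xs"
  using w
proof (rule CE.lie_der_d)
  show "D (comm_bracket dot x y) = comm_bracket dot (D x) y + comm_bracket dot x (D y)" for x y
    by (simp add: comm_bracket_def D_simps D_derivation)
  show "hom_der D (hom_act dot x v) = hom_act dot (D x) v + hom_act dot x (hom_der D v)"
    if v: "v \<in> linmaps" for x v
    using v
    by (simp add: fun_eq_iff hom_der_def hom_act_def D_simps D_derivation dot_simps linear_additive)
qed (rule hom_der_simps)

text \<open>An integer power, since the exponent is -1 for n = 1.\<close>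

definition omega_sign :: "nat \<Rightarrow> 'k" where
  "omega_sign n = (-1) powi (int n - 2)"

text \<open>This alternation turns the commutation of \<open>d\<close> with the Lie derivative along
  \<open>D\<close> into anticommutation of \<open>d_reg\<close> with \<open>Omega\<close>.\<close>

lemma omega_sign_Suc: "omega_sign (Suc n) = - omega_sign n"
  using power_int_add_1[of "-1 :: 'k" "int n - 2"] by (simp add: omega_sign_def algebra_simps)

lemma Omega_eq_lie_der:
  assumes f: "f \<in> Hom_wedge scale m"
  shows "Omega scale D (Suc m) f = (\<lambda>xs. scale (- omega_sign (Suc m))
    (uncurry_last (lie_der D (hom_der D) (curry_last f)) xs))"
proof
  fix xs
  show "Omega scale D (Suc m) f xs = scale (- omega_sign (Suc m))
    (uncurry_last (lie_der D (hom_der D) (curry_last f)) xs)"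
  proof (cases "length xs = Suc m")
    case True
    then obtain ys z where xs: "xs = ys @ [z]" and ys: "length ys = m"
      by (cases xs rule: rev_cases) auto
    \<comment> \<open>The summands with \<open>i < m\<close> are the argument terms of
      \<open>lie_der\<close>; the one with \<open>i = m\<close> joins \<open>D (f xs)\<close> to
      give \<open>- hom_der D\<close>.\<close>
    have "(\<Sum>i<Suc m. f (xs[i := D (xs ! i)])) - D (f xs)
        = - lie_der D (hom_der D) (curry_last f) ys z"
      unfolding xs
      by (simp add: lie_der_eq_sum ys hom_der_def sum_fun_apply curry_last_def list_update_append
          nth_append)
    then show ?thesis
      by (simp add: Omega_def True omega_sign_def) (simp add: xs uncurry_last_def)
  next
    case False
    have "lie_der D (hom_der D) (curry_last f) (butlast xs) = 0" if "xs \<noteq> []"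
      using False that Hom_wedgeD(2)[OF f]
      by (intro lie_der_degree[of _ m]) (auto simp: hom_der_def D_simps fun_eq_iff)
    then show ?thesis using False by (simp add: Omega_def uncurry_last_def)
  qed
qed

lemma uncurry_lie_der_Hom_wedge:
  assumes f: "f \<in> Hom_wedge scale m"
  shows "uncurry_last (lie_der D (hom_der D) (curry_last f)) \<in> Hom_wedge scale m"
  using Hom_wedgeD[OF f]
  by (intro uncurry_Hom_wedge lie_der_D_alt lie_der_degree[of _ m])
    (auto simp: hom_der_def D_simps fun_eq_iff)

lemma Omega_Hom_wedge:
  "f \<in> Hom_wedge scale m \<Longrightarrow> Omega scale D (Suc m) f \<in> Hom_wedge scale m"
  by (simp only: Omega_eq_lie_der Hom_wedge_scale uncurry_lie_der_Hom_wedge)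

lemma Omega_d_reg:
  assumes f: "f \<in> Hom_wedge scale m"
  shows "d_reg scale dot (Suc m) (Omega scale D (Suc m) f)
    + Omega scale D (Suc (Suc m)) (d_reg scale dot (Suc m) f) = 0"
proof
  fix xs
  show "(d_reg scale dot (Suc m) (Omega scale D (Suc m) f)
      + Omega scale D (Suc (Suc m)) (d_reg scale dot (Suc m) f)) xs = 0 xs"
    unfolding Omega_eq_lie_der[OF f] Omega_eq_lie_der[OF d_reg_Hom_wedge[OF f]] d_reg_scale
      d_reg_eq_CE[OF uncurry_lie_der_Hom_wedge[OF f]]
    by (simp add: omega_sign_Suc[of "Suc m"] d_reg_eq_CE[OF f] uncurry_last_def
        lie_der_D_d[OF Hom_wedgeD(1)[OF f]])
qed

lemma Omega_add: "Omega scale D n (f + g) = Omega scale D n f + Omega scale D n g"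
  by (rule ext) (simp add: Omega_def D_simps sum.distrib flip: scale_right_distrib)

lemma Omega_scale: "Omega scale D n (\<lambda>xs. scale c (f xs)) = (\<lambda>xs. scale c (Omega scale D n f xs))"
  by (rule ext) (simp add: Omega_def D_simps scale_sum_right[symmetric]
      scale_right_diff_distrib[symmetric] scale_left_commute)

lemma Omega_0 [simp]: "Omega scale D n 0 = 0"
  by (rule ext) (simp add: Omega_def D_simps)

section \<open>The cochain complex\<close>

lemma cochains_cases:
  assumes "p \<in> cochains scale n"
  obtains (zero) "n = 0" "p = 0"
  | (one) f where "n = 1" "p = (f, 0)" "f \<in> Hom_wedge scale 0"
  | (ge_two) m f t where "n = Suc (Suc m)" "p = (f, t)" "f \<in> Hom_wedge scale (Suc m)" "t \<in> Hom_wedge scale m"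
proof (cases n)
  case 0
  then show ?thesis using assms zero by (simp add: cochains_def)
next
  case (Suc k)
  then show ?thesis using assms one ge_two by (cases k) (auto simp: cochains_def)
qed

lemma cochains_Suc_Suc: "cochains scale (Suc (Suc m)) = Hom_wedge scale (Suc m) \<times> Hom_wedge scale m"
  by (simp add: cochains_def)

lemma D_bar_0: "D_bar scale dot D n 0 = 0"
  by (simp add: D_bar_def zero_prod_def)

lemma D_bar_closed:
  assumes "p \<in> cochains scale n"
  shows "D_bar scale dot D n p \<in> cochains scale (Suc n)"
  using assms
proof (cases rule: cochains_cases)
  case zero
  then show ?thesis by (simp add: D_bar_def cochains_def Hom_wedge_zero)
next
  case (one f)
  then show ?thesis
    using d_reg_Hom_wedge[of f 0] Omega_Hom_wedge[of f 0] by (simp add: D_bar_def cochains_def)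
next
  case (ge_two m f t)
  then show ?thesis
    by (simp add: D_bar_def cochains_Suc_Suc d_reg_Hom_wedge Hom_wedge_add Omega_Hom_wedge)
qed

text \<open>For (f, t) the first component is d_reg d_reg f. The second is d_reg d_reg t plus the
  mixed terms d_reg Omega f + Omega d_reg f, which vanish by \<open>Omega_d_reg\<close>.\<close>

lemma D_bar_D_bar:
  assumes "p \<in> cochains scale n"
  shows "D_bar scale dot D (Suc n) (D_bar scale dot D n p) = 0"
  using assms
proof (cases rule: cochains_cases)
  case zero
  then show ?thesis by (simp add: D_bar_0)
next
  case (one f)
  then show ?thesis
    using d_reg_d_reg[of f 0] Omega_d_reg[of f 0] by (simp add: D_bar_def zero_prod_def)
next
  case (ge_two m f t)
  then show ?thesis
    using Omega_d_reg[of f "Suc m"]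
    by (simp add: D_bar_def zero_prod_def d_reg_d_reg d_reg_add)
qed

lemma D_bar_cochain_complex: "cochain_complex (cochain_scale scale) (cochains scale) (D_bar scale dot D)"
proof -
  interpret M: vector_space "cochain_scale scale"
    by (rule vector_space_cochain_scale) (rule vector_space_axioms)
  show ?thesis
  proof
    show "M.subspace (cochains scale n)" for n
      by (auto simp: M.subspace_def cochains_def cochain_scale_def Hom_wedge_zero Hom_wedge_add
          Hom_wedge_scale mem_Times_iff zero_prod_def func_zero[symmetric])
    show "D_bar scale dot D n (p + q) = D_bar scale dot D n p + D_bar scale dot D n q" for n p q
      by (simp add: D_bar_def d_reg_add Omega_add)
    show "D_bar scale dot D n (cochain_scale scale c p) = cochain_scale scale c (D_bar scale dot D n p)"
      for n c p
      by (simp add: D_bar_def cochain_scale_def d_reg_scale Omega_scale fun_eq_iff scale_right_distrib)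
  qed (rule D_bar_closed D_bar_D_bar; assumption)+
qed

end

theorem theorem4p10:
  fixes scale :: "'k::{alg_closed_field, field_char_0} \<Rightarrow> 'g::ab_group_add \<Rightarrow> 'g"
    and dot :: "'g \<Rightarrow> 'g \<Rightarrow> 'g"
    and D :: "'g \<Rightarrow> 'g"
  assumes "regular_pre_LieDer_pair scale dot D"
  shows "cochain_complex (cochain_scale scale) (cochains scale) (D_bar scale dot D) \<and>
         (\<forall>c \<in> direct_sum (cochains scale).
           total_differential (D_bar scale dot D)
             (total_differential (D_bar scale dot D) c) = 0)"
proof (intro conjI ballI)
  interpret regular_pre_LieDer_pair scale dot D by (rule assms)
  show "cochain_complex (cochain_scale scale) (cochains scale) (D_bar scale dot D)"
    by (rule D_bar_cochain_complex)
  fix c assume "c \<in> direct_sum (cochains scale)"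
  then have c: "c n \<in> cochains scale n" for n by (simp add: direct_sum_def)
  show "total_differential (D_bar scale dot D) (total_differential (D_bar scale dot D) c) = 0"
    \<comment> \<open>Component 0 is zero by definition and component 1 is \<open>D_bar\<close> of
      zero; component n + 2 is \<open>D_bar\<close> applied twice to \<open>c n\<close>.\<close>
    using D_bar_D_bar[OF c]
    by (intro ext) (simp add: total_differential_def D_bar_0 split: nat.split)
qed

end
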